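(* Let $V$ be a finite nonempty set and $r=(r(i,j))_{i,j\in V}$ an irreducible family of transition rates with $r(i,i)=0$ for all $i$. Let $\mu$ be the invariant distribution associated to $r$ and $\mathcal{M}=\{i\in V:\mu(i)=\max_{j\in V}\mu(j)\}$. Let $A$ be a nonempty subset of $V$ and $\partial_A\Sigma=\{\zeta\in\Sigma:\sum_{j\in A}\zeta(j)=1\}$. The following assertions are equivalent: (a) for every $u\in\partial_A\Sigma$, one has $\zeta^u_t=u$ for all $t\ge0$; (b) $A$ is $r$-absorbing and $\lambda^A(i)=0$ for all $i\in A$; (c) $A\subseteq\mathcal{M}$.
   Context: $\Sigma=\{u\in[0,1]^V:\sum_{i\in V}u(i)=1\}$. The invariant distribution $\mu$ of $r$ is the probability on $V$ with $\sum_{i\in V}(\mu(i)r(i,j)-\mu(j)r(j,i))=0$ for all $j\in V$. Trace rates: for $k\in V$ and nonempty $B\subseteq V$, let $T^k_B$ be the hitting time of $B$ by the continuous-time random walk on $V$ with jump rates $r$ started at $k$, and $T^k_j=T^k_{\{j\}}$. For nonempty $A\subseteq V$ and $i\ne j$ in $A$ put $r^A(i,j)=r(i,j)+\sum_{k\notin A}r(i,k)P(T^k_A=T^k_j)$, and $r^A(i,i)=0$. Put $\lambda^A(i)=\sum_{j\in A}[r^A(j,i)-r^A(i,j)]$ for $i\in A$. A set $A\subseteq V$ is $r$-absorbing if $A=V$ or $\lambda^{A\cup\{j\}}(j)\le0$ for all $j\in V\setminus A$. For $S\subseteq V$, $\mathcal{A}(S)$ is the intersection of all $r$-absorbing subsets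 of $V$ containing $S$. The path $\zeta^u$: for $v\in\Sigma$ let $\mathcal{S}(v)=\{i\in V:v(i)>0\}$, $\mathcal{A}(v)=\mathcal{A}(\mathcal{S}(v))$, and let $\lambda^v\in\mathbb{R}^V$ be given by $\lambda^v(i)=\lambda^{\mathcal{A}(v)}(i)$ for $i\in\mathcal{A}(v)$ and $\lambda^v(i)=0$ otherwise. Let $\mathcal{S}_\downarrow(v)=\{i\in\mathcal{S}(v):\lambda^v(i)<0\}$; this set is nonempty whenever $\lambda^v\neq 0$. Given $u\in\Sigma$, set $(T_0,v_0)=(0,u)$. Given $(T_k,v_k)$: if $\lambda^{v_k}=0$, stop and set $f=k$; otherwise put $T^{v_k}=\min\{-v_k(i)/\lambda^{v_k}(i): i\in\mathcal{S}_\downarrow(v_k)\}\in(0,\infty)$, $v_{k+1}=v_k+T^{v_k}\lambda^{v_k}$, $T_{k+1}=T_k+T^{v_k}$. The procedure stops after finitely many steps. Then $\zeta^u_t=v_k+(t-T_k)\lambda^{v_k}$ for $T_k\le t<T_{k+1}$, $k<f$, and $\zeta^u_t=v_f$ for $t\ge T_f$. *)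

theory Defs
  imports "HOL-Probability.Probability" "HOL-Library.Extended_Nat"
begin

text \<open>The finite nonempty set \<open>V\<close> is a type \<open>'v\<close> of class \<open>finite\<close>.\<close>

definition irreducible_rates :: "('v::finite \<Rightarrow> 'v \<Rightarrow> real) \<Rightarrow> bool" where
  "irreducible_rates r \<longleftrightarrow>
     (\<forall>i j. 0 \<le> r i j) \<and> (\<forall>i. r i i = 0) \<and> (\<forall>i j. (i, j) \<in> {(a, b). 0 < r a b}\<^sup>*)"

definition prob_simplex :: "('v::finite \<Rightarrow> real) set" where
  "prob_simplex = {u. (\<forall>i. 0 \<le> u i \<and> u i \<le> 1) \<and> (\<Sum>i\<in>UNIV. u i) = 1}"

definition invariant_distribution :: "('v::finite \<Rightarrow> 'v \<Rightarrow> real) \<Rightarrow> ('v \<Rightarrow> real) \<Rightarrow> bool" where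
  "invariant_distribution r \<mu> \<longleftrightarrow>
     \<mu> \<in> prob_simplex \<and> (\<forall>j. (\<Sum>i\<in>UNIV. \<mu> i * r i j - \<mu> j * r j i) = 0)"

definition face :: "'v::finite set \<Rightarrow> ('v \<Rightarrow> real) set" where
  "face A = {u \<in> prob_simplex. (\<Sum>j\<in>A. u j) = 1}"


section \<open>The continuous-time random walk\<close>

definition exit_rate :: "('v::finite \<Rightarrow> 'v \<Rightarrow> real) \<Rightarrow> 'v \<Rightarrow> real" where
  "exit_rate r i = (\<Sum>j\<in>UNIV. r i j)"

definition jump_pmf :: "('v::finite \<Rightarrow> 'v \<Rightarrow> real) \<Rightarrow> 'v \<Rightarrow> 'v pmf" where
  "jump_pmf r i =
     (if exit_rate r i = 0 then return_pmf i else embed_pmf (\<lambda>j. r i j / exit_rate r i))"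

text \<open>
  The walk is realised by its jump chain and holding times. The randomness is an i.i.d. sequence
  of pairs of independent \<open>E\<^sub>n\<close> and \<open>F\<^sub>n\<close>, where \<open>E\<^sub>n\<close> is exponential with parameter 1 and
  \<open>F\<^sub>n :: 'v \<Rightarrow> 'v\<close> is a random map such that \<open>F\<^sub>n i\<close> has law \<open>jump_pmf r i\<close>. The jump chain moves
  from its \<open>n\<close>-th state \<open>Y\<^sub>n\<close> to \<open>Y\<^sub>n\<^sub>+\<^sub>1 = F\<^sub>n Y\<^sub>n\<close>, after a holding time
  \<open>E\<^sub>n / exit_rate r Y\<^sub>n\<close>, which is infinite when the exit rate vanishes and \<open>E\<^sub>n > 0\<close>.
\<close>

definition walk_space ::
    "('v::finite \<Rightarrow> 'v \<Rightarrow> real) \<Rightarrow> (real \<times> ('v \<Rightarrow> 'v)) stream measure" where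
  "walk_space r =
     stream_space (density lborel (exponential_density 1)
                     \<Otimes>\<^sub>M measure_pmf (Pi_pmf UNIV undefined (jump_pmf r)))"

primrec jump_chain :: "'v::finite \<Rightarrow> (real \<times> ('v \<Rightarrow> 'v)) stream \<Rightarrow> nat \<Rightarrow> 'v" where
  "jump_chain k \<omega> 0 = k"
| "jump_chain k \<omega> (Suc n) = snd (\<omega> !! n) (jump_chain k \<omega> n)"

definition jump_time ::
    "('v::finite \<Rightarrow> 'v \<Rightarrow> real) \<Rightarrow> 'v \<Rightarrow> (real \<times> ('v \<Rightarrow> 'v)) stream \<Rightarrow> nat \<Rightarrow> ennreal" where
  "jump_time r k \<omega> n =
     (\<Sum>m<n. ennreal (fst (\<omega> !! m)) / ennreal (exit_rate r (jump_chain k \<omega> m)))"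

text \<open>If \<open>t\<close> is not below any jump time, the position at time \<open>t\<close> is arbitrary; as \<open>'v\<close> is finite,
  the jump times almost surely tend to (or equal) infinity, so this is a null event.\<close>

definition walk ::
    "('v::finite \<Rightarrow> 'v \<Rightarrow> real) \<Rightarrow> 'v \<Rightarrow> (real \<times> ('v \<Rightarrow> 'v)) stream \<Rightarrow> real \<Rightarrow> 'v" where
  "walk r k \<omega> t = jump_chain k \<omega> (LEAST n. ennreal t < jump_time r k \<omega> (Suc n))"

definition hitting_time ::
    "('v::finite \<Rightarrow> 'v \<Rightarrow> real) \<Rightarrow> 'v \<Rightarrow> 'v set \<Rightarrow> (real \<times> ('v \<Rightarrow> 'v)) stream \<Rightarrow> ennreal" where
  "hitting_time r k B \<omega> = (INF t\<in>{t. 0 \<le> t \<and> walk r k \<omega> t \<in> B}. ennreal t)"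


section \<open>Trace rates and absorbing sets\<close>

definition trace_rate :: "('v::finite \<Rightarrow> 'v \<Rightarrow> real) \<Rightarrow> 'v set \<Rightarrow> 'v \<Rightarrow> 'v \<Rightarrow> real" where
  "trace_rate r A i j =
     (if i = j then 0
      else r i j + (\<Sum>k\<in>- A. r i k *
             \<P>(\<omega> in walk_space r. hitting_time r k A \<omega> = hitting_time r k {j} \<omega>)))"

definition trace_drift :: "('v::finite \<Rightarrow> 'v \<Rightarrow> real) \<Rightarrow> 'v set \<Rightarrow> 'v \<Rightarrow> real" where
  "trace_drift r A i = (\<Sum>j\<in>A. trace_rate r A j i - trace_rate r A i j)"

definition absorbing :: "('v::finite \<Rightarrow> 'v \<Rightarrow> real) \<Rightarrow> 'v set \<Rightarrow> bool" where
  "absorbing r A \<longleftrightarrow> A = UNIV \<or> (\<forall>j\<in>- A. trace_drift r (A \<union> {j}) j \<le> 0)"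

definition absorbing_hull :: "('v::finite \<Rightarrow> 'v \<Rightarrow> real) \<Rightarrow> 'v set \<Rightarrow> 'v set" where
  "absorbing_hull r S = \<Inter>{B. absorbing r B \<and> S \<subseteq> B}"


section \<open>The path started at a point of the simplex\<close>

definition supp :: "('v::finite \<Rightarrow> real) \<Rightarrow> 'v set" where
  "supp v = {i. 0 < v i}"

definition drift :: "('v::finite \<Rightarrow> 'v \<Rightarrow> real) \<Rightarrow> ('v \<Rightarrow> real) \<Rightarrow> 'v \<Rightarrow> real" where
  "drift r v i =
     (if i \<in> absorbing_hull r (supp v) then trace_drift r (absorbing_hull r (supp v)) i else 0)"

definition supp_down :: "('v::finite \<Rightarrow> 'v \<Rightarrow> real) \<Rightarrow> ('v \<Rightarrow> real) \<Rightarrow> 'v set" where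
  "supp_down r v = {i \<in> supp v. drift r v i < 0}"

definition step_time :: "('v::finite \<Rightarrow> 'v \<Rightarrow> real) \<Rightarrow> ('v \<Rightarrow> real) \<Rightarrow> real" where
  "step_time r v = Min ((\<lambda>i. - v i / drift r v i) ` supp_down r v)"

text \<open>The pairs \<open>(T\<^sub>k, v\<^sub>k)\<close>; the sequence is continued constantly once the procedure stops.\<close>

primrec path_node ::
    "('v::finite \<Rightarrow> 'v \<Rightarrow> real) \<Rightarrow> ('v \<Rightarrow> real) \<Rightarrow> nat \<Rightarrow> real \<times> ('v \<Rightarrow> real)" where
  "path_node r u 0 = (0, u)"
| "path_node r u (Suc k) =
     (let (T, v) = path_node r u k in
      if drift r v = (\<lambda>_. 0) then (T, v)
      else (T + step_time r v, \<lambda>i. v i + step_time r v * drift r v i))"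

abbreviation node_time :: "('v::finite \<Rightarrow> 'v \<Rightarrow> real) \<Rightarrow> ('v \<Rightarrow> real) \<Rightarrow> nat \<Rightarrow> real" where
  "node_time r u k \<equiv> fst (path_node r u k)"

abbreviation node_point :: "('v::finite \<Rightarrow> 'v \<Rightarrow> real) \<Rightarrow> ('v \<Rightarrow> real) \<Rightarrow> nat \<Rightarrow> 'v \<Rightarrow> real" where
  "node_point r u k \<equiv> snd (path_node r u k)"

text \<open>The index \<open>f\<close> at which the procedure stops, with value \<open>\<infinity>\<close> should it never stop.\<close>

definition stop_index :: "('v::finite \<Rightarrow> 'v \<Rightarrow> real) \<Rightarrow> ('v \<Rightarrow> real) \<Rightarrow> enat" where
  "stop_index r u = (INF k\<in>{k. drift r (node_point r u k) = (\<lambda>_. 0)}. enat k)"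

definition zeta_path :: "('v::finite \<Rightarrow> 'v \<Rightarrow> real) \<Rightarrow> ('v \<Rightarrow> real) \<Rightarrow> real \<Rightarrow> 'v \<Rightarrow> real" where
  "zeta_path r u t =
     (let on_piece = (\<lambda>k. enat k < stop_index r u \<and>
                          node_time r u k \<le> t \<and> t < node_time r u (Suc k))
      in if \<exists>k. on_piece k
         then (let k = (THE k. on_piece k); v = node_point r u k
               in (\<lambda>i. v i + (t - node_time r u k) * drift r v i))
         else node_point r u (the_enat (stop_index r u)))"

end

theory Submission
  imports Defs
begin

text \<open>
  Let \<open>L\<close> be the generator of the walk and call \<open>y\<close> an equilibrium of \<open>A\<close> if \<open>y = 1\<close> on \<open>A\<close> and
  \<open>y L = 0\<close> off \<open>A\<close>. Pairing \<open>y L\<close> with the hitting probabilities of \<open>A\<close>, which are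
  \<open>L\<close>-harmonic off \<open>A\<close>, shows that \<open>\<lambda>\<^sup>A = y L\<close> on \<open>A\<close>, and likewise that \<open>A\<close> is absorbing iff
  \<open>y \<le> 1\<close>. Hence (b) says that \<open>y\<close> is an invariant measure with maximum 1 attained on all of
  \<open>A\<close>, i.e. (c). A comparison principle for \<open>y L \<le> 0\<close> shows that absorbing sets are closed under
  nonempty intersections and that a negative drift on a hull \<open>A(S)\<close> occurs only on \<open>S\<close>; so the
  path from \<open>u\<close> is constant iff its initial drift vanishes, which gives (a).
\<close>

section \<open>Hitting probabilities of the walk\<close>

abbreviation step_space :: "('v::finite \<Rightarrow> 'v \<Rightarrow> real) \<Rightarrow> (real \<times> ('v \<Rightarrow> 'v)) measure" where
  "step_space r \<equiv> density lborel (exponential_density 1)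
                     \<Otimes>\<^sub>M measure_pmf (Pi_pmf UNIV undefined (jump_pmf r))"

lemma prob_space_step: "prob_space (step_space r)"
proof -
  interpret E: prob_space "density lborel (exponential_density 1)"
    by (rule prob_space_exponential_density) simp
  interpret P: pair_prob_space "density lborel (exponential_density 1)"
      "measure_pmf (Pi_pmf UNIV undefined (jump_pmf r))" ..
  show ?thesis by (rule P.prob_space_axioms)
qed

lemma prob_space_walk: "prob_space (walk_space r)"
  unfolding walk_space_def by (rule prob_space.prob_space_stream_space[OF prob_space_step])

lemma space_step [simp]: "space (step_space r) = UNIV"
  by (simp add: space_pair_measure)

lemma space_walk [simp]: "space (walk_space r) = UNIV"
  by (simp add: walk_space_def space_stream_space)

lemma measurable_snth_walk [measurable]:
  "(\<lambda>\<omega>. \<omega> !! n) \<in> measurable (walk_space r) (step_space r)"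
  unfolding walk_space_def by measurable

lemma measurable_holding [measurable]:
  "(\<lambda>\<omega>. fst (\<omega> !! n)) \<in> borel_measurable (walk_space r)"
  using measurable_compose[OF measurable_snth_walk measurable_fst, of n r] by simp

lemma measurable_jump_map:
  "(\<lambda>\<omega>. snd (\<omega> !! n)) \<in> measurable (walk_space r) (count_space UNIV)"
  using measurable_compose[OF measurable_snth_walk measurable_snd, of n r] by simp

lemma measurable_jump_chain [measurable]:
  "(\<lambda>\<omega>. jump_chain k \<omega> n) \<in> measurable (walk_space r) (count_space UNIV)"
proof (induction n)
  case (Suc n)
  have "(\<lambda>\<omega>. snd (\<omega> !! n) i) \<in> measurable (walk_space r) (count_space UNIV)" for i
    by (rule measurable_compose[OF measurable_jump_map]) simp
  with Suc show ?case
    by (simp add: measurable_compose_countable)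
qed simp

lemma measurable_jump_time [measurable]:
  "(\<lambda>\<omega>. jump_time r k \<omega> n) \<in> borel_measurable (walk_space r)"
  unfolding jump_time_def by measurable

lemma measurable_walk [measurable]:
  "(\<lambda>\<omega>. walk r k \<omega> t) \<in> measurable (walk_space r) (count_space UNIV)"
  unfolding walk_def
  by (rule measurable_compose_countable[where f = "\<lambda>n \<omega>. jump_chain k \<omega> n"]) measurable

section \<open>Right continuity of the paths and measurability of hitting times\<close>

lemma jump_time_mono: "mono (jump_time r k \<omega>)"
  unfolding jump_time_def by (intro incseq_SucI) simp

text \<open>The index chosen by \<open>LEAST\<close> at time \<open>t\<close> remains the right one
  until the next jump time, which is strictly larger than \<open>t\<close>.\<close>

lemma walk_right_continuous:
  assumes "0 \<le> t"
  obtains s where "t < s" and "\<And>t'. t \<le> t' \<Longrightarrow> t' < s \<Longrightarrow> walk r k \<omega> t' = walk r k \<omega> t"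
proof (cases "\<exists>n. ennreal t < jump_time r k \<omega> (Suc n)")
  case True
  define n where "n = (LEAST n. ennreal t < jump_time r k \<omega> (Suc n))"
  have n: "ennreal t < jump_time r k \<omega> (Suc n)"
    using True unfolding n_def by (rule LeastI_ex)
  obtain s where s: "t < s" "ennreal s \<le> jump_time r k \<omega> (Suc n)"
  proof (cases "jump_time r k \<omega> (Suc n)")
    case (real x)
    with n assms show ?thesis by (intro that[of x]) (auto simp: ennreal_less_iff)
  next
    case top
    then show ?thesis by (intro that[of "t + 1"]) auto
  qed
  have "(LEAST n. ennreal t' < jump_time r k \<omega> (Suc n)) = n" if "t \<le> t'" "t' < s" for t'
  proof (rule Least_equality)
    have "ennreal t' < ennreal s" using that assms by (simp add: ennreal_lessI)
    with s show "ennreal t' < jump_time r k \<omega> (Suc n)" by simp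
    fix m assume "ennreal t' < jump_time r k \<omega> (Suc m)"
    with ennreal_leI[OF that(1)] have "ennreal t < jump_time r k \<omega> (Suc m)"
      by (rule order_le_less_trans)
    then show "n \<le> m" unfolding n_def by (rule Least_le)
  qed
  then show ?thesis
    using s(1) by (intro that[of s]) (simp_all add: walk_def flip: n_def)
next
  \<comment> \<open>No jump time exceeds \<open>t\<close> or any later time, so the predicate under
    \<open>LEAST\<close> is constantly false and the path keeps a single arbitrary value.\<close>
  case False
  then have "\<not> ennreal t' < jump_time r k \<omega> (Suc n)" if "t \<le> t'" for t' n
    using order_le_less_trans[OF ennreal_leI[OF that], of "jump_time r k \<omega> (Suc n)"] by blast
  with False show ?thesis by (intro that[of "t + 1"]) (auto simp: walk_def)
qed

text \<open>By right continuity of the paths, rational times suffice.\<close>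

lemma hitting_time_rational:
  "hitting_time r k B \<omega> =
     (INF q. if 0 \<le> q \<and> walk r k \<omega> (of_rat q) \<in> B then ennreal (of_rat q) else \<top>)"
  (is "_ = (INF q. ?f q)")
proof (rule antisym)
  show "hitting_time r k B \<omega> \<le> (INF q. ?f q)"
    unfolding hitting_time_def by (intro INF_greatest) (auto intro!: INF_lower)
  show "(INF q. ?f q) \<le> hitting_time r k B \<omega>"
    unfolding hitting_time_def
  proof (intro INF_greatest)
    fix t assume "t \<in> {t. 0 \<le> t \<and> walk r k \<omega> t \<in> B}"
    then have t: "0 \<le> t" "walk r k \<omega> t \<in> B" by auto
    obtain s where s: "t < s" "\<And>t'. t \<le> t' \<Longrightarrow> t' < s \<Longrightarrow> walk r k \<omega> t' = walk r k \<omega> t"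
      by (rule walk_right_continuous[OF t(1)]) blast
    show "(INF q. ?f q) \<le> ennreal t"
    proof (rule ennreal_le_epsilon)
      fix e :: real assume "0 < e"
      then obtain q where q: "t < of_rat q" "of_rat q < min s (t + e)"
        using of_rat_dense[of t "min s (t + e)"] s(1) by auto
      have "0 \<le> q" using q t(1) by (metis le_less_trans less_imp_le zero_le_of_rat_iff)
      moreover have "walk r k \<omega> (of_rat q) \<in> B" using s(2)[of "of_rat q"] q t by simp
      ultimately have "(INF q. ?f q) \<le> ennreal (of_rat q)"
        by (intro INF_lower2[of q]) auto
      also have "\<dots> \<le> ennreal t + ennreal e"
        using q t \<open>0 < e\<close> by (simp flip: ennreal_plus add: ennreal_leI)
      finally show "(INF q. ?f q) \<le> ennreal t + ennreal e" .
    qed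
  qed
qed

lemma measurable_hitting_time [measurable]:
  "hitting_time r k B \<in> borel_measurable (walk_space r)"
  unfolding hitting_time_rational by measurable

section \<open>Decomposition of a path at its first jump\<close>

lemma jump_chain_Stream: "jump_chain k (x ## X) (Suc n) = jump_chain (snd x k) X n"
  by (induction n) simp_all

lemma jump_time_Stream:
  "jump_time r k (x ## X) (Suc n) =
     ennreal (fst x) / ennreal (exit_rate r k) + jump_time r (snd x k) X n"
  unfolding jump_time_def
  by (simp add: sum.lessThan_Suc_shift jump_chain_Stream del: sum.lessThan_Suc jump_chain.simps(2))

text \<open>All starting states are quantified at once, so that the property can be used for the
  tail of a stream from whatever state the first jump leads to.\<close>

definition no_explosion ::
    "('v::finite \<Rightarrow> 'v \<Rightarrow> real) \<Rightarrow> (real \<times> ('v \<Rightarrow> 'v)) stream \<Rightarrow> bool" where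
  "no_explosion r \<omega> \<longleftrightarrow> (\<forall>k t. \<exists>n. ennreal t < jump_time r k \<omega> (Suc n))"

lemma walk_Stream_before:
  assumes "0 \<le> t" and "ennreal t < ennreal (fst x) / ennreal (exit_rate r k)"
  shows "walk r k (x ## X) t = k"
proof -
  have "ennreal t < jump_time r k (x ## X) (Suc 0)"
    using assms(2) by (simp add: jump_time_def)
  then have "(LEAST n. ennreal t < jump_time r k (x ## X) (Suc n)) = 0"
    by (intro Least_eq_0)
  then show ?thesis by (simp add: walk_def)
qed

lemma walk_Stream_after:
  assumes "no_explosion r X" and q: "0 < exit_rate r k" and x: "0 \<le> fst x"
    and t: "fst x / exit_rate r k \<le> t"
  shows "walk r k (x ## X) t = walk r (snd x k) X (t - fst x / exit_rate r k)"
proof -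
  define s where "s = fst x / exit_rate r k"
  have s: "0 \<le> s" "s \<le> t" using q x t by (simp_all add: s_def)
  have jt: "jump_time r k (x ## X) (Suc n) = ennreal s + jump_time r (snd x k) X n" for n
    using q x by (simp add: jump_time_Stream s_def divide_ennreal)
  have shift: "ennreal t < ennreal s + a \<longleftrightarrow> ennreal (t - s) < a" for a
  proof -
    have "ennreal t = ennreal s + ennreal (t - s)"
      using s by (simp flip: ennreal_plus)
    then show ?thesis by (simp add: ennreal_add_left_cancel_less)
  qed
  obtain n where n: "ennreal (t - s) < jump_time r (snd x k) X (Suc n)"
    using assms(1) unfolding no_explosion_def by blast
  have "(LEAST n. ennreal t < jump_time r k (x ## X) (Suc n)) =
      Suc (LEAST n. ennreal t < jump_time r k (x ## X) (Suc (Suc n)))"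
  \<comment> \<open>Non-explosion of the tail supplies the witness. Index 0 is excluded because the
    first jump time is \<open>s\<close> itself, which does not exceed \<open>t\<close>.\<close>
  proof (rule Least_Suc)
    show "ennreal t < jump_time r k (x ## X) (Suc (Suc n))"
      using n unfolding jt shift .
    show "\<not> ennreal t < jump_time r k (x ## X) (Suc 0)"
      unfolding jt shift by (simp add: jump_time_def)
  qed
  also have "\<dots> = Suc (LEAST n. ennreal (t - s) < jump_time r (snd x k) X (Suc n))"
    unfolding jt shift ..
  finally show ?thesis
    by (simp only: walk_def jump_chain_Stream s_def)
qed

text \<open>Translation by \<open>c\<close> is monotone and continuous, hence commutes with infima;
  over an empty index set both sides are infinite.\<close>

lemma INF_ennreal_add_left:
  fixes c :: ennreal
  shows "(INF i\<in>I. c + f i) = c + (INF i\<in>I. f i)"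
proof (cases "I = {}")
  case False
  then show ?thesis
    using continuous_at_Inf_mono[of "\<lambda>x. c + x" "f ` I"]
      continuous_add[of "at_right (Inf (f ` I))" "\<lambda>x. c" "\<lambda>x. x"]
    by (auto simp: mono_def image_comp)
qed (simp add: top_ennreal.rep_eq)

text \<open>The walk rests at \<open>k\<close>, outside \<open>B\<close>, until the first jump, so
  the times spent in \<open>B\<close> are those of the tail path translated by the first holding
  time.\<close>

lemma hitting_time_Stream:
  assumes X: "no_explosion r X" and q: "0 < exit_rate r k" and x: "0 < fst x" and k: "k \<notin> B"
  shows "hitting_time r k B (x ## X) =
    ennreal (fst x / exit_rate r k) + hitting_time r (snd x k) B X"
proof -
  define s where "s = fst x / exit_rate r k"
  have s: "0 < s" using q x by (simp add: s_def)
  have eq: "{t. 0 \<le> t \<and> walk r k (x ## X) t \<in> B} =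
      (+) s ` {t. 0 \<le> t \<and> walk r (snd x k) X t \<in> B}"
  proof (intro equalityI subsetI)
    fix t assume "t \<in> {t. 0 \<le> t \<and> walk r k (x ## X) t \<in> B}"
    then have t: "0 \<le> t" "walk r k (x ## X) t \<in> B" by auto
    have "s \<le> t"
      using walk_Stream_before[of t x r k X] t k x q
      by (force simp: s_def divide_ennreal ennreal_less_iff)
    then have "t - s \<in> {t. 0 \<le> t \<and> walk r (snd x k) X t \<in> B}"
      using walk_Stream_after[OF X q] x t by (simp add: s_def)
    then show "t \<in> (+) s ` {t. 0 \<le> t \<and> walk r (snd x k) X t \<in> B}"
      by (intro image_eqI[of _ _ "t - s"]) auto
  next
    fix t assume "t \<in> (+) s ` {t. 0 \<le> t \<and> walk r (snd x k) X t \<in> B}"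
    then obtain t' where "0 \<le> t'" "walk r (snd x k) X t' \<in> B" "t = s + t'" by auto
    then show "t \<in> {t. 0 \<le> t \<and> walk r k (x ## X) t \<in> B}"
      using walk_Stream_after[OF X q, of x t] x s by (simp add: s_def)
  qed
  have "hitting_time r k B (x ## X) =
      (INF t\<in>{t. 0 \<le> t \<and> walk r (snd x k) X t \<in> B}. ennreal s + ennreal t)"
    unfolding hitting_time_def eq image_image
    using s by (intro INF_cong) auto
  also have "\<dots> = ennreal s + hitting_time r (snd x k) B X"
    unfolding hitting_time_def
    by (rule INF_ennreal_add_left)
  finally show ?thesis by (simp add: s_def)
qed

section \<open>Almost sure non-explosion\<close>

lemma AE_step_pos: "AE x in step_space r. 0 < fst x"
proof -
  interpret E: prob_space "density lborel (exponential_density 1)"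
    by (rule prob_space_exponential_density) simp
  interpret P: pair_prob_space "density lborel (exponential_density 1)"
      "measure_pmf (Pi_pmf UNIV undefined (jump_pmf r))" ..
  have "AE x in density lborel (exponential_density 1). 0 < (x::real)"
    using AE_lborel_singleton[of "0::real"]
    by (auto simp: AE_density exponential_density_def elim!: eventually_mono)
  moreover have "{x \<in> space (step_space r). 0 < fst x} \<in> sets (step_space r)" by measurable
  ultimately show ?thesis
    by (intro P.AE_pair_measure) simp_all
qed

lemma AE_walk_pos: "AE \<omega> in walk_space r. \<forall>n. 0 < fst (\<omega> !! n)"
proof -
  have "AE \<omega> in walk_space r. stream_all (\<lambda>x. 0 < fst x) \<omega>"
    unfolding walk_space_def
    by (rule prob_space.AE_stream_all[OF prob_space_step _ AE_step_pos]) simp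
  then show ?thesis by (rule eventually_mono) (simp add: stream_all_def)
qed

text \<open>The tail of an i.i.d. sequence has the law of the whole sequence; the induction splits
  off one entry at a time.\<close>

lemma AE_walk_sdrop:
  assumes [measurable]: "Measurable.pred (walk_space r) P" and "AE \<omega> in walk_space r. P \<omega>"
  shows "AE \<omega> in walk_space r. P (sdrop n \<omega>)"
proof (induction n)
  case (Suc n)
  have [measurable]: "Measurable.pred (stream_space (step_space r)) P"
    using assms(1) by (simp add: walk_space_def)
  show ?case
    using Suc unfolding walk_space_def
    by (subst prob_space.AE_stream_space[OF prob_space_step]) simp_all
qed (use assms in simp)

lemma prob_step_small: "emeasure (step_space r) {x. fst x < 1} < 1"
proof -
  let ?E = "density lborel (exponential_density 1)"
  interpret E: prob_space ?E by (rule prob_space_exponential_density) simp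
  \<comment> \<open>The exponential density is positive on the interval from 1 to 2, which would
    otherwise be a Lebesgue null set.\<close>
  have "\<not> (AE x in ?E. x < 1)"
  proof
    assume "AE x in ?E. x < 1"
    then have "AE x::real in lborel. x \<notin> {1..2}"
      by (auto simp: AE_density exponential_density_def elim!: eventually_mono)
    then have "{1..2::real} \<in> null_sets lborel" by (subst AE_iff_null_sets) auto
    then show False by (simp add: null_sets_def)
  qed
  then have "emeasure ?E {..<1} \<noteq> 1"
    using E.prob_eq_1[of "{..<1}"] by (simp add: E.emeasure_eq_measure)
  then have "emeasure ?E {..<1} < 1"
    using E.emeasure_le_1[of "{..<1}"] by (simp add: less_le)
  moreover have "{x. fst x < 1} = {..<1::real} \<times> (UNIV :: ('a \<Rightarrow> 'a) set)" by auto
  ultimately show ?thesis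
    by (simp add: sigma_finite_measure.emeasure_pair_measure_Times measure_pmf.sigma_finite_measure_axioms
        measure_pmf.emeasure_space_1[simplified])
qed

text \<open>Splitting off the first entry shows that the probability \<open>p\<close> that all
  entries stay below 1 equals \<open>p\<close> times a factor smaller than 1, so
  \<open>p = 0\<close>.\<close>

lemma AE_walk_large: "AE \<omega> in walk_space r. \<exists>n. 1 \<le> fst (\<omega> !! n)"
proof -
  interpret step: prob_space "step_space r" by (rule prob_space_step)
  interpret W: prob_space "walk_space r" by (rule prob_space_walk)
  define S :: "(real \<times> ('a \<Rightarrow> 'a)) stream set" where "S = {\<omega>. \<forall>n. fst (\<omega> !! n) < 1}"
  have S [measurable]: "S \<in> sets (walk_space r)"
  proof -
    have "{\<omega> \<in> space (walk_space r). \<forall>n. fst (\<omega> !! n) < 1} \<in> sets (walk_space r)" by measurable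
    then show ?thesis by (simp add: S_def)
  qed
  define p where "p = emeasure (walk_space r) S"
  have "p = (\<integral>\<^sup>+x. emeasure (walk_space r) {X. x ## X \<in> S} \<partial>step_space r)"
    using step.emeasure_stream_space[of S] S
    by (simp add: p_def walk_space_def[symmetric])
  also have "\<dots> = (\<integral>\<^sup>+x. p * indicator {x. fst x < 1} x \<partial>step_space r)"
  proof (rule nn_integral_cong)
    fix x :: "real \<times> ('a \<Rightarrow> 'a)"
    have "{X. x ## X \<in> S} = (if fst x < 1 then S else {})"
      by (auto simp: S_def Stream_snth split: nat.splits)
    then show "emeasure (walk_space r) {X. x ## X \<in> S} = p * indicator {x. fst x < 1} x"
      by (simp add: p_def)
  qed
  also have "\<dots> = p * emeasure (step_space r) {x. fst x < 1}"
  proof (rule nn_integral_cmult_indicator)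
    have "{x \<in> space (step_space r). fst x < 1} \<in> sets (step_space r)" by measurable
    then show "{x. fst x < 1} \<in> sets (step_space r)" by simp
  qed
  finally have p: "p = p * emeasure (step_space r) {x. fst x < 1}" .
  have "p = 0"
  proof (rule ccontr)
    assume "p \<noteq> 0"
    moreover have "p < \<top>" by (simp add: p_def W.emeasure_eq_measure)
    ultimately have "p * emeasure (step_space r) {x. fst x < 1} < p * 1"
      using prob_step_small by (intro ennreal_mult_strict_left_mono) (auto simp: zero_less_iff_neq_zero)
    with p show False by simp
  qed
  then show ?thesis
    by (subst AE_iff_measurable[OF S]) (auto simp: p_def S_def not_le)
qed

lemma AE_no_explosion: "AE \<omega> in walk_space r. no_explosion r \<omega>"
proof -
  \<comment> \<open>Applied to every tail, the previous result yields infinitely many exponential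
    variables that are at least 1.\<close>
  have "AE \<omega> in walk_space r. \<forall>m. \<exists>n. 1 \<le> fst (sdrop m \<omega> !! n)"
    unfolding AE_all_countable
    by (intro allI AE_walk_sdrop[OF _ AE_walk_large]) measurable
  then show ?thesis
  proof (rule eventually_mono)
    fix \<omega> :: "(real \<times> ('a \<Rightarrow> 'a)) stream" assume "\<forall>m. \<exists>n. 1 \<le> fst (sdrop m \<omega> !! n)"
    then have large: "\<exists>n\<ge>m. 1 \<le> fst (\<omega> !! n)" for m
      by (metis le_add1 sdrop_snth)
    \<comment> \<open>\<open>Q\<close> is a positive upper bound of all exit rates, so each
      exponential variable that is at least 1 adds at least \<open>1 / Q\<close> to the jump
      times.\<close>
    define Q where "Q = 1 + (\<Sum>i\<in>UNIV. \<bar>exit_rate r i\<bar>)"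
    have Q: "0 < Q" "exit_rate r i \<le> Q" for i
      unfolding Q_def using member_le_sum[of i UNIV "\<lambda>i. \<bar>exit_rate r i\<bar>"]
      by (auto intro: add_pos_nonneg sum_nonneg)
    show "no_explosion r \<omega>"
      unfolding no_explosion_def
    proof (intro allI)
      fix k t
      have grow: "\<exists>n. ennreal (real K / Q) \<le> jump_time r k \<omega> n" for K
      proof (induction K)
        case (Suc K)
        then obtain m where m: "ennreal (real K / Q) \<le> jump_time r k \<omega> m" by blast
        obtain n where n: "m \<le> n" "1 \<le> fst (\<omega> !! n)" using large by blast
        have "ennreal (real (Suc K) / Q) = ennreal (real K / Q) + ennreal (1 / Q)"
          using Q by (simp flip: ennreal_plus add: add_divide_distrib)
        also have "\<dots> \<le> jump_time r k \<omega> n + ennreal (fst (\<omega> !! n)) / ennreal (exit_rate r (jump_chain k \<omega> n))"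
        proof (rule add_mono)
          show "ennreal (real K / Q) \<le> jump_time r k \<omega> n"
            using m monoD[OF jump_time_mono n(1)] by (rule order_trans)
          show "ennreal (1 / Q) \<le> ennreal (fst (\<omega> !! n)) / ennreal (exit_rate r (jump_chain k \<omega> n))"
          proof (cases "0 < exit_rate r (jump_chain k \<omega> n)")
            case True
            then show ?thesis
              using n Q by (simp add: divide_ennreal ennreal_leI frac_le)
          next
            \<comment> \<open>A nonpositive rate becomes 0 in \<open>ennreal\<close>, and a positive
              number divided by 0 is infinite there.\<close>
            case False
            then show ?thesis using n by (simp add: ennreal_neg ennreal_divide_zero)
          qed
        qed
        also have "\<dots> = jump_time r k \<omega> (Suc n)" by (simp add: jump_time_def)
        finally show ?case by blast
      qed (use zero_le in auto)
      obtain K :: nat where "t * Q < real K" using reals_Archimedean2 by blast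
      then have "ennreal t < ennreal (real (Suc K) / Q)"
        using Q by (intro ennreal_lessI) (auto simp: field_simps)
      also obtain n where "ennreal (real (Suc K) / Q) \<le> jump_time r k \<omega> n" using grow by blast
      note this
      also have "jump_time r k \<omega> n \<le> jump_time r k \<omega> (Suc n)"
        by (rule monoD[OF jump_time_mono]) simp
      finally show "\<exists>n. ennreal t < jump_time r k \<omega> (Suc n)" by blast
    qed
  qed
qed

section \<open>Boundary values and first-step equation of the hitting probabilities\<close>

definition hit_prob :: "('v::finite \<Rightarrow> 'v \<Rightarrow> real) \<Rightarrow> 'v set \<Rightarrow> 'v \<Rightarrow> 'v \<Rightarrow> real" where
  "hit_prob r A j k =
     \<P>(\<omega> in walk_space r. hitting_time r k A \<omega> = hitting_time r k {j} \<omega>)"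

lemma hit_prob_nonneg: "0 \<le> hit_prob r A j k"
  by (simp add: hit_prob_def)

text \<open>The first holding time is almost surely positive: a set containing \<open>k\<close> is
  hit at time 0, any other set only after a positive time.\<close>

lemma hit_prob_boundary:
  assumes k: "k \<in> A" and j: "j \<in> A"
  shows "hit_prob r A j k = (if k = j then 1 else 0)"
proof -
  interpret W: prob_space "walk_space r" by (rule prob_space_walk)
  have "AE \<omega> in walk_space r. hitting_time r k A \<omega> = hitting_time r k {j} \<omega> \<longleftrightarrow> k = j"
    using AE_walk_pos
  proof (rule eventually_mono)
    fix \<omega> :: "(real \<times> ('a \<Rightarrow> 'a)) stream" assume "\<forall>n. 0 < fst (\<omega> !! n)"
    then have "0 < fst (\<omega> !! 0)" by blast
    then have "0 < ennreal (fst (shd \<omega>)) / ennreal (exit_rate r k)"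
      by (simp add: ennreal_zero_less_divide)
    \<comment> \<open>The holding time may be infinite, so a finite positive bound \<open>s\<close>
      below it is used instead.\<close>
    then obtain e where e: "0 < e" "e < ennreal (fst (shd \<omega>)) / ennreal (exit_rate r k)"
      using dense by blast
    obtain s where s: "e = ennreal s" "0 < s"
      using e by (cases e) auto
    have stay: "walk r k \<omega> t = k" if "0 \<le> t" "t \<le> s" for t
    proof -
      have "ennreal t < ennreal (fst (shd \<omega>)) / ennreal (exit_rate r k)"
        using e(2) ennreal_leI[OF that(2)] unfolding s by (rule le_less_trans[rotated])
      then show ?thesis using walk_Stream_before[OF that(1), of "shd \<omega>" r k "stl \<omega>"] by simp
    qed
    have hit: "hitting_time r k B \<omega> = 0" if "k \<in> B" for B
    proof -
      have "hitting_time r k B \<omega> \<le> ennreal 0"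
        unfolding hitting_time_def using stay[of 0] s that by (intro INF_lower) auto
      then show ?thesis by simp
    qed
    have miss: "hitting_time r k B \<omega> \<noteq> 0" if "k \<notin> B" for B
    proof -
      have "ennreal s \<le> hitting_time r k B \<omega>"
        unfolding hitting_time_def
      proof (rule INF_greatest)
        fix t assume "t \<in> {t. 0 \<le> t \<and> walk r k \<omega> t \<in> B}"
        with stay[of t] that have "s \<le> t" by (cases "t \<le> s") auto
        then show "ennreal s \<le> ennreal t" by (rule ennreal_leI)
      qed
      with s show ?thesis by auto
    qed
    show "hitting_time r k A \<omega> = hitting_time r k {j} \<omega> \<longleftrightarrow> k = j"
      using hit[OF k] hit[of "{j}"] miss[of "{j}"] by (cases "k = j") auto
  qed
  moreover have "{\<omega> \<in> space (walk_space r). hitting_time r k A \<omega> = hitting_time r k {j} \<omega>}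
      \<in> sets (walk_space r)" by measurable
  moreover have "{\<omega> \<in> space (walk_space r). k = j} \<in> sets (walk_space r)" by measurable
  ultimately have "hit_prob r A j k = \<P>(\<omega> in walk_space r. k = j)"
    unfolding hit_prob_def by (intro measure_eq_AE) (simp_all split: if_splits)
  then show ?thesis using W.prob_space by (cases "k = j") auto
qed

lemma pmf_jump_pmf:
  assumes "\<And>i j. 0 \<le> r i j" and q: "exit_rate r k \<noteq> 0"
  shows "pmf (jump_pmf r k) l = r k l / exit_rate r k"
proof -
  have "0 \<le> exit_rate r k" unfolding exit_rate_def by (intro sum_nonneg assms(1))
  with q have pos: "0 < exit_rate r k" by simp
  have "(\<Sum>l\<in>UNIV. r k l / exit_rate r k) = 1"
    using q by (simp add: exit_rate_def flip: sum_divide_distrib)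
  then have "(\<integral>\<^sup>+l. ennreal (r k l / exit_rate r k) \<partial>count_space UNIV) = 1"
    using assms(1) pos by (simp add: nn_integral_count_space_finite sum_ennreal)
  then show ?thesis
    using q assms(1) pos by (simp add: jump_pmf_def pmf_embed_pmf)
qed

lemma hit_prob_first_step:
  assumes r: "\<And>i j. 0 \<le> r i j" and q: "0 < exit_rate r k" and k: "k \<notin> A" and j: "j \<in> A"
  shows "hit_prob r A j k = (\<Sum>l\<in>UNIV. r k l / exit_rate r k * hit_prob r A j l)"
proof -
  interpret step: prob_space "step_space r" by (rule prob_space_step)
  interpret W: prob_space "walk_space r" by (rule prob_space_walk)
  interpret E: prob_space "density lborel (exponential_density 1)"
    by (rule prob_space_exponential_density) simp
  let ?F = "Pi_pmf UNIV undefined (jump_pmf r)"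
  let ?eq = "\<lambda>l \<omega>. hitting_time r l A \<omega> = hitting_time r l {j} \<omega>"
  have "ennreal (hit_prob r A j k) =
      (\<integral>\<^sup>+x. ennreal (\<P>(X in walk_space r. ?eq k (x ## X))) \<partial>step_space r)"
  proof -
    have "{\<omega> \<in> space (walk_space r). ?eq k \<omega>} \<in> sets (walk_space r)" by measurable
    then show ?thesis
      unfolding hit_prob_def walk_space_def by (rule step.prob_stream_space)
  qed
  \<comment> \<open>Since \<open>k\<close> lies neither in \<open>A\<close> nor in
    \<open>{j}\<close>, both hitting times are those of the tail plus the same finite holding time,
    which cancels.\<close>
  also have "\<dots> = (\<integral>\<^sup>+x. ennreal (hit_prob r A j (snd x k)) \<partial>step_space r)"
  proof (rule nn_integral_cong_AE, rule eventually_mono[OF AE_step_pos])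
    fix x :: "real \<times> ('a \<Rightarrow> 'a)" assume x: "0 < fst x"
    have [measurable]: "(\<lambda>X. x ## X) \<in> measurable (walk_space r) (walk_space r)"
      unfolding walk_space_def by (intro measurable_Stream measurable_const measurable_ident_sets) simp_all
    have "AE X in walk_space r. ?eq k (x ## X) \<longleftrightarrow> ?eq (snd x k) X"
      using AE_no_explosion
    proof (rule eventually_mono)
      fix X assume X: "no_explosion r X"
      have "k \<notin> {j}" using k j by blast
      then show "?eq k (x ## X) \<longleftrightarrow> ?eq (snd x k) X"
        by (simp add: hitting_time_Stream[OF X q x] k ennreal_add_left_cancel)
    qed
    moreover have "{X \<in> space (walk_space r). ?eq k (x ## X)} \<in> sets (walk_space r)"
      by measurable
    moreover have "{X \<in> space (walk_space r). ?eq (snd x k) X} \<in> sets (walk_space r)"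
      by measurable
    ultimately have "\<P>(X in walk_space r. ?eq k (x ## X)) = hit_prob r A j (snd x k)"
      unfolding hit_prob_def by (intro measure_eq_AE) simp_all
    then show "ennreal (\<P>(X in walk_space r. ?eq k (x ## X))) =
        ennreal (hit_prob r A j (snd x k))" by simp
  qed
  \<comment> \<open>The holding time integrates out; of the random map only its value at
    \<open>k\<close> matters, and this has law \<open>jump_pmf r k\<close>.\<close>
  also have "\<dots> = (\<integral>\<^sup>+f. ennreal (hit_prob r A j (f k)) \<partial>measure_pmf ?F)"
  proof (subst measure_pmf.nn_integral_fst[symmetric])
    show "(\<lambda>x. ennreal (hit_prob r A j (snd x k))) \<in> borel_measurable (step_space r)"
      by (rule measurable_compose[OF measurable_snd]) simp
  qed (use E.emeasure_space_1 in simp)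
  also have "\<dots> = (\<integral>\<^sup>+l. ennreal (hit_prob r A j l) \<partial>measure_pmf (map_pmf (\<lambda>f. f k) ?F))"
    by simp
  also have "map_pmf (\<lambda>f. f k) ?F = jump_pmf r k"
    by (simp add: Pi_pmf_component)
  also have "(\<integral>\<^sup>+l. ennreal (hit_prob r A j l) \<partial>measure_pmf (jump_pmf r k)) =
      ennreal (\<Sum>l\<in>UNIV. r k l / exit_rate r k * hit_prob r A j l)"
    using r q by (simp add: nn_integral_measure_pmf nn_integral_count_space_finite pmf_jump_pmf
        hit_prob_nonneg sum_ennreal flip: ennreal_mult)
  finally show ?thesis
    using r q by (subst (asm) ennreal_inj)
      (auto intro!: sum_nonneg mult_nonneg_nonneg divide_nonneg_pos simp: hit_prob_nonneg)
qed


section \<open>The generator and its dual\<close>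

lemma irreducible_rates_nonneg: "irreducible_rates r \<Longrightarrow> 0 \<le> r i j"
  by (simp add: irreducible_rates_def)

lemma irreducible_closed_UNIV:
  assumes "irreducible_rates r" and "a \<in> N"
    and closed: "\<And>i j. i \<in> N \<Longrightarrow> 0 < r i j \<Longrightarrow> j \<in> N"
  shows "N = UNIV"
proof -
  have "b \<in> N" for b
  proof -
    have "(a, b) \<in> {(a, b). 0 < r a b}\<^sup>*"
      using assms(1) by (simp add: irreducible_rates_def)
    then show ?thesis
      by (induction rule: rtrancl_induct) (use assms(2) closed in auto)
  qed
  then show ?thesis by blast
qed

text \<open>A state that cannot be left forms a closed set, hence the whole space by irreducibility;
  the second state \<open>j\<close> rules this out.\<close>

lemma exit_rate_pos:
  assumes irr: "irreducible_rates r" and "i \<noteq> j"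
  shows "0 < exit_rate r i"
proof (rule ccontr)
  assume "\<not> 0 < exit_rate r i"
  then have "(\<Sum>l\<in>UNIV. r i l) = 0"
    unfolding exit_rate_def
    by (meson irr irreducible_rates_nonneg linorder_not_le nless_le sum_nonneg)
  then have "r i l = 0" for l
    by (simp add: sum_nonneg_eq_0_iff irreducible_rates_nonneg[OF irr])
  then have "{i} = UNIV"
    by (intro irreducible_closed_UNIV[OF irr, of i]) auto
  then have "j \<in> {i}" by simp
  with \<open>i \<noteq> j\<close> show False by simp
qed

definition generator :: "('v::finite \<Rightarrow> 'v \<Rightarrow> real) \<Rightarrow> ('v \<Rightarrow> real) \<Rightarrow> 'v \<Rightarrow> real" where
  "generator r f i = (\<Sum>j\<in>UNIV. r i j * (f j - f i))"

text \<open>This is the row vector \<open>y L\<close> for the generator \<open>L\<close>, with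
  \<open>y\<close> a possibly signed measure; it vanishes exactly when \<open>y\<close> is
  invariant.\<close>

definition net_flow :: "('v::finite \<Rightarrow> 'v \<Rightarrow> real) \<Rightarrow> ('v \<Rightarrow> real) \<Rightarrow> 'v \<Rightarrow> real" where
  "net_flow r y j = (\<Sum>i\<in>UNIV. y i * r i j - y j * r j i)"

lemma generator_const [simp]: "generator r (\<lambda>_. c) i = 0"
  by (simp add: generator_def)

lemma generator_sum:
  "generator r (\<lambda>k. \<Sum>j\<in>A. f j k) i = (\<Sum>j\<in>A. generator r (f j) i)"
  unfolding generator_def
  by (simp add: sum_distrib_left right_diff_distrib sum_subtractf sum.swap[of _ A])

lemma generator_diff:
  "generator r (\<lambda>k. f k - g k) i = generator r f i - generator r g i"
  by (simp add: generator_def algebra_simps sum.distrib sum_subtractf)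

lemma net_flow_add: "net_flow r (\<lambda>i. x i + y i) j = net_flow r x j + net_flow r y j"
  by (simp add: net_flow_def algebra_simps sum.distrib sum_subtractf)

lemma net_flow_scale: "net_flow r (\<lambda>i. c * y i) j = c * net_flow r y j"
  by (simp add: net_flow_def sum_distrib_left algebra_simps)

lemma net_flow_diff: "net_flow r (\<lambda>i. x i - y i) j = net_flow r x j - net_flow r y j"
  using net_flow_add[of r x "\<lambda>i. (-1) * y i" j] net_flow_scale[of r "-1" y j] by simp

text \<open>The duality \<open>(y L) f = y (L f)\<close>, an exchange of the order of
  summation.\<close>

lemma sum_net_flow_mult:
  "(\<Sum>k\<in>UNIV. net_flow r y k * f k) = (\<Sum>i\<in>UNIV. y i * generator r f i)"
proof -
  have "(\<Sum>k\<in>UNIV. net_flow r y k * f k) =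
      (\<Sum>k\<in>UNIV. \<Sum>i\<in>UNIV. y i * r i k * f k) - (\<Sum>k\<in>UNIV. \<Sum>i\<in>UNIV. y k * r k i * f k)"
    by (simp add: net_flow_def sum_distrib_right sum_subtractf left_diff_distrib)
  also have "(\<Sum>k\<in>UNIV. \<Sum>i\<in>UNIV. y i * r i k * f k) = (\<Sum>i\<in>UNIV. \<Sum>k\<in>UNIV. y i * r i k * f k)"
    by (rule sum.swap)
  also have "\<dots> - (\<Sum>k\<in>UNIV. \<Sum>i\<in>UNIV. y k * r k i * f k) = (\<Sum>i\<in>UNIV. y i * generator r f i)"
    by (simp add: generator_def sum_distrib_left sum_subtractf algebra_simps)
  finally show ?thesis .
qed

lemma sum_net_flow: "(\<Sum>k\<in>UNIV. net_flow r y k) = 0"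
  using sum_net_flow_mult[of r y "\<lambda>_. 1"] by simp

text \<open>Pair \<open>z\<close> with the indicator of \<open>N\<close>, the set where
  \<open>z\<close> is negative. Each term \<open>z a * generator r ?f a\<close> is nonnegative,
  while by duality their sum is at most 0, because \<open>N\<close> avoids \<open>C\<close>. So all
  terms vanish, no rate leads out of \<open>N\<close>, and irreducibility makes a nonempty
  \<open>N\<close> everything, against \<open>C \<noteq> {}\<close>.\<close>

lemma net_flow_comparison:
  assumes irr: "irreducible_rates r" and "C \<noteq> {}"
    and nonneg: "\<And>i. i \<in> C \<Longrightarrow> 0 \<le> z i"
    and super: "\<And>j. j \<notin> C \<Longrightarrow> net_flow r z j \<le> 0"
  shows "0 \<le> z i"
proof (rule ccontr)
  assume neg: "\<not> 0 \<le> z i"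
  define N where "N = {i. z i < 0}"
  let ?f = "indicator N :: _ \<Rightarrow> real"
  note r0 = irreducible_rates_nonneg[OF irr]
  have term_nonneg: "0 \<le> z a * generator r ?f a" for a
  proof (cases "a \<in> N")
    case True
    then have "generator r ?f a \<le> 0"
      unfolding generator_def by (auto intro!: sum_nonpos mult_nonneg_nonpos r0 simp: indicator_def)
    with True show ?thesis by (simp add: N_def mult_nonpos_nonpos)
  next
    case False
    then have "0 \<le> generator r ?f a"
      unfolding generator_def by (auto intro!: sum_nonneg r0 simp: indicator_def)
    with False show ?thesis by (simp add: N_def)
  qed
  have "(\<Sum>a\<in>UNIV. z a * generator r ?f a) = (\<Sum>k\<in>UNIV. net_flow r z k * ?f k)"
    by (simp add: sum_net_flow_mult)
  also have "\<dots> \<le> 0"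
    using nonneg super by (intro sum_nonpos) (force simp: N_def indicator_def)
  finally have "(\<Sum>a\<in>UNIV. z a * generator r ?f a) = 0"
    using sum_nonneg[of UNIV "\<lambda>a. z a * generator r ?f a"] term_nonneg by force
  then have zero: "z a * generator r ?f a = 0" for a
    by (simp add: sum_nonneg_eq_0_iff term_nonneg)
  have "N = UNIV"
  proof (rule irreducible_closed_UNIV[OF irr])
    show "i \<in> N" using neg by (simp add: N_def)
    fix a b assume a: "a \<in> N" and ab: "0 < r a b"
    have "(\<Sum>l\<in>UNIV. r a l * (1 - ?f l)) = 0"
      using zero[of a] a by (auto simp: N_def generator_def sum_subtractf right_diff_distrib)
    moreover have "0 \<le> r a l * (1 - ?f l)" for l
      by (simp add: r0 indicator_def)
    ultimately have "r a b * (1 - ?f b) = 0"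
      by (simp add: sum_nonneg_eq_0_iff)
    with ab show "b \<in> N" by (simp add: indicator_def split: if_splits)
  qed
  moreover obtain c where "c \<in> C" using \<open>C \<noteq> {}\<close> by blast
  ultimately show False using nonneg[of c] by (metis N_def UNIV_I mem_Collect_eq not_less)
qed

lemma net_flow_unique:
  assumes irr: "irreducible_rates r" and C: "C \<noteq> {}"
    and "\<And>i. i \<in> C \<Longrightarrow> x i = y i"
    and "\<And>j. j \<notin> C \<Longrightarrow> net_flow r x j = net_flow r y j"
  shows "x = y"
proof
  fix i
  have "0 \<le> x i - y i"
    by (rule net_flow_comparison[OF irr C]) (simp_all add: assms net_flow_diff)
  moreover have "0 \<le> y i - x i"
    by (rule net_flow_comparison[OF irr C]) (simp_all add: assms net_flow_diff)
  ultimately show "x i = y i" by simp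
qed

text \<open>Values on \<open>C\<close> and net flows off \<open>C\<close> together form one linear
  endomorphism \<open>\<Phi>\<close> of \<open>real^'a\<close>. Uniqueness makes it injective, so by
  finite dimension it is surjective.\<close>

lemma net_flow_solvable:
  assumes irr: "irreducible_rates r" and C: "C \<noteq> {}"
  obtains y where "\<And>i. i \<in> C \<Longrightarrow> y i = b i" and "\<And>j. j \<notin> C \<Longrightarrow> net_flow r y j = b j"
proof -
  define \<Phi> :: "real^'a \<Rightarrow> real^'a"
    where "\<Phi> x = (\<chi> i. if i \<in> C then x $ i else net_flow r (($) x) i)" for x
  have "linear \<Phi>"
    by (rule linearI)
      (auto simp: \<Phi>_def vec_eq_iff simp flip: net_flow_add net_flow_scale
        intro!: arg_cong[of _ _ "\<lambda>y. net_flow r y _"])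
  moreover have "inj \<Phi>"
  proof (rule injI)
    fix x y assume eq: "\<Phi> x = \<Phi> y"
    have "(if i \<in> C then x $ i else net_flow r (($) x) i) =
        (if i \<in> C then y $ i else net_flow r (($) y) i)" for i
      using arg_cong[OF eq, of "\<lambda>v. v $ i"] by (simp add: \<Phi>_def)
    then have "($) x = ($) y"
      by (intro net_flow_unique[OF irr C]) (metis+)
    then show "x = y" by (simp add: vec_eq_iff)
  qed
  ultimately have "surj \<Phi>"
    by (rule linear_inj_imp_surj)
  then obtain x where x: "\<Phi> x = (\<chi> i. b i)" by (metis surjD)
  have "(if i \<in> C then x $ i else net_flow r (($) x) i) = b i" for i
    using arg_cong[OF x, of "\<lambda>v. v $ i"] by (simp add: \<Phi>_def)
  then show ?thesis by (intro that[of "($) x"]) metis+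
qed

text \<open>The dual problem \<open>net_flow r y = f\<close> off \<open>C\<close> is solvable, and pairing \<open>f\<close> with
  its solution gives \<open>\<Sum> f\<^sup>2 = 0\<close>.\<close>

lemma harmonic_zero:
  assumes irr: "irreducible_rates r" and C: "C \<noteq> {}"
    and zero: "\<And>i. i \<in> C \<Longrightarrow> f i = 0"
    and harm: "\<And>i. i \<notin> C \<Longrightarrow> generator r f i = 0"
  shows "f i = 0"
proof -
  obtain y where y: "\<And>i. i \<in> C \<Longrightarrow> y i = 0" "\<And>j. j \<notin> C \<Longrightarrow> net_flow r y j = f j"
    by (rule net_flow_solvable[OF irr C, of "\<lambda>i. if i \<in> C then 0 else f i"]) auto
  have "(\<Sum>k\<in>UNIV. f k * f k) = (\<Sum>k\<in>UNIV. net_flow r y k * f k)"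
    by (rule sum.cong) (use y zero in fastforce)+
  also have "\<dots> = (\<Sum>i\<in>UNIV. y i * generator r f i)"
    by (rule sum_net_flow_mult)
  also have "\<dots> = 0"
    by (rule sum.neutral) (use y harm in force)
  finally show ?thesis by (simp add: sum_nonneg_eq_0_iff)
qed

section \<open>Positivity of the invariant distribution\<close>

lemma invariant_distribution_net_flow:
  "invariant_distribution r \<mu> \<Longrightarrow> net_flow r \<mu> j = 0"
  by (simp add: invariant_distribution_def net_flow_def)

lemma invariant_distribution_pos:
  assumes irr: "irreducible_rates r" and inv: "invariant_distribution r \<mu>"
  shows "0 < \<mu> i"
proof (rule ccontr)
  have \<mu>: "0 \<le> \<mu> j" "(\<Sum>j\<in>UNIV. \<mu> j) = 1" for j
    using inv by (auto simp: invariant_distribution_def prob_simplex_def)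
  assume "\<not> 0 < \<mu> i"
  with \<mu>(1)[of i] have "\<mu> i = 0" by simp
  \<comment> \<open>Both measures vanish at \<open>i\<close> and have zero net flow everywhere, so
    uniqueness with boundary \<open>{i}\<close> identifies them.\<close>
  then have "\<mu> = (\<lambda>_. 0)"
    by (intro net_flow_unique[OF irr, of "{i}"])
      (simp_all add: invariant_distribution_net_flow[OF inv] net_flow_def[of _ "\<lambda>_. 0"])
  with \<mu>(2) show False by simp
qed


section \<open>Trace rates and equilibria\<close>

lemma hit_prob_harmonic:
  assumes irr: "irreducible_rates r" and k: "k \<notin> A" and j: "j \<in> A"
  shows "generator r (hit_prob r A j) k = 0"
proof -
  have q: "0 < exit_rate r k" using k j by (intro exit_rate_pos[OF irr, of k j]) auto
  have "hit_prob r A j k = (\<Sum>l\<in>UNIV. r k l / exit_rate r k * hit_prob r A j l)"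
    by (rule hit_prob_first_step[OF irreducible_rates_nonneg[OF irr] q k j])
  then have "exit_rate r k * hit_prob r A j k = (\<Sum>l\<in>UNIV. r k l * hit_prob r A j l)"
    using q by (simp add: sum_distrib_left)
  then show ?thesis
    by (simp add: generator_def right_diff_distrib sum_subtractf exit_rate_def sum_distrib_right)
qed

text \<open>The difference from 1 vanishes on \<open>A\<close> and is harmonic off \<open>A\<close>,
  hence is zero; this stands in for a pathwise proof that \<open>A\<close> is entered almost
  surely.\<close>

lemma sum_hit_prob:
  assumes irr: "irreducible_rates r" and A: "A \<noteq> {}"
  shows "(\<Sum>j\<in>A. hit_prob r A j k) = 1"
proof -
  have "(\<Sum>j\<in>A. hit_prob r A j k) - 1 = 0"
  proof (rule harmonic_zero[OF irr A])
    fix i assume "i \<in> A"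
    then show "(\<Sum>j\<in>A. hit_prob r A j i) - 1 = 0" by (simp add: hit_prob_boundary)
  next
    fix i assume "i \<notin> A"
    then show "generator r (\<lambda>k. (\<Sum>j\<in>A. hit_prob r A j k) - 1) i = 0"
      by (simp add: generator_diff generator_sum hit_prob_harmonic[OF irr])
  qed
  then show ?thesis by simp
qed

text \<open>At \<open>i\<close> the function \<open>hit_prob r A j\<close> vanishes, so its
  generator is a weighted sum of its values; the part over \<open>A\<close> contributes just
  \<open>r i j\<close>.\<close>

lemma trace_rate_eq_generator:
  assumes "i \<in> A" and "j \<in> A" and "i \<noteq> j"
  shows "trace_rate r A i j = generator r (hit_prob r A j) i"
proof -
  have "generator r (hit_prob r A j) i = (\<Sum>k\<in>UNIV. r i k * hit_prob r A j k)"
    using assms by (simp add: generator_def hit_prob_boundary)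
  also have "\<dots> = (\<Sum>k\<in>A. r i k * hit_prob r A j k) + (\<Sum>k\<in>- A. r i k * hit_prob r A j k)"
    by (simp add: Compl_eq_Diff_UNIV sum.subset_diff[of A UNIV] add.commute)
  also have "(\<Sum>k\<in>A. r i k * hit_prob r A j k) = (\<Sum>k\<in>A. if k = j then r i k else 0)"
    using assms by (intro sum.cong) (auto simp: hit_prob_boundary)
  also have "\<dots> = r i j" using assms by simp
  finally show ?thesis
    unfolding trace_rate_def hit_prob_def[symmetric] using assms by simp
qed

text \<open>The hitting probabilities sum to 1, so their generators sum to 0; the trace rates omit
  precisely the diagonal term.\<close>

lemma sum_trace_rate_out:
  assumes irr: "irreducible_rates r" and i: "i \<in> A"
  shows "(\<Sum>j\<in>A. trace_rate r A i j) = - generator r (hit_prob r A i) i"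
proof -
  have "(\<Sum>j\<in>A. generator r (hit_prob r A j) i) = generator r (\<lambda>k. \<Sum>j\<in>A. hit_prob r A j k) i"
    by (simp add: generator_sum)
  also have "\<dots> = 0" using i by (subst sum_hit_prob[OF irr]) auto
  finally have "(\<Sum>j\<in>A. generator r (hit_prob r A j) i) = 0" .
  moreover have "(\<Sum>j\<in>A - {i}. trace_rate r A i j) = (\<Sum>j\<in>A - {i}. generator r (hit_prob r A j) i)"
    using i by (intro sum.cong) (auto simp: trace_rate_eq_generator)
  ultimately show ?thesis
    using i by (simp add: sum.remove[of A i] trace_rate_def)
qed

text \<open>The incoming rates are the terms with \<open>j\<close> different from \<open>i\<close>,
  and minus the total outgoing rate is the missing diagonal term.\<close>

lemma trace_drift_eq_generator:
  assumes irr: "irreducible_rates r" and i: "i \<in> A"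
  shows "trace_drift r A i = (\<Sum>j\<in>A. generator r (hit_prob r A i) j)"
proof -
  have "trace_drift r A i = (\<Sum>j\<in>A. trace_rate r A j i) - (\<Sum>j\<in>A. trace_rate r A i j)"
    by (simp add: trace_drift_def sum_subtractf)
  also have "(\<Sum>j\<in>A. trace_rate r A j i) = (\<Sum>j\<in>A - {i}. generator r (hit_prob r A i) j)"
    using i by (simp add: sum.remove[of A i] trace_rate_def[of r A i i])
      (rule sum.cong, auto simp: trace_rate_eq_generator)
  finally show ?thesis
    using i by (simp only: sum_trace_rate_out[OF irr i]) (simp add: sum.remove[of A i])
qed

section \<open>Equilibria of a set and the trace drift\<close>

definition equilibrium :: "('v::finite \<Rightarrow> 'v \<Rightarrow> real) \<Rightarrow> 'v set \<Rightarrow> ('v \<Rightarrow> real) \<Rightarrow> bool" where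
  "equilibrium r A y \<longleftrightarrow> (\<forall>i\<in>A. y i = 1) \<and> (\<forall>j\<in>- A. net_flow r y j = 0)"

lemma equilibrium_exists:
  assumes "irreducible_rates r" and "A \<noteq> {}"
  obtains y where "equilibrium r A y"
  by (rule net_flow_solvable[OF assms, of "indicator A"]) (auto simp: equilibrium_def)

lemma equilibrium_le:
  assumes "irreducible_rates r" and "A \<noteq> {}" and "equilibrium r A y"
    and "\<And>i. i \<in> A \<Longrightarrow> z i = 1" and "\<And>j. j \<notin> A \<Longrightarrow> net_flow r z j \<le> 0"
  shows "y i \<le> z i"
  using net_flow_comparison[OF assms(1,2), of "\<lambda>i. z i - y i" i] assms(3-5)
  by (simp add: equilibrium_def net_flow_diff)

lemma trace_drift_equilibrium:
  assumes irr: "irreducible_rates r" and y: "equilibrium r A y" and i: "i \<in> A"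
  shows "trace_drift r A i = net_flow r y i"
proof -
  have "trace_drift r A i = (\<Sum>j\<in>A. generator r (hit_prob r A i) j)"
    by (rule trace_drift_eq_generator[OF irr i])
  \<comment> \<open>The weight \<open>y\<close> is 1 on \<open>A\<close>, and off \<open>A\<close>
    the hitting probability is harmonic, so the added terms are 0.\<close>
  also have "\<dots> = (\<Sum>j\<in>UNIV. y j * generator r (hit_prob r A i) j)"
    using y i by (intro sum.mono_neutral_cong_left)
      (auto simp: equilibrium_def hit_prob_harmonic[OF irr])
  also have "\<dots> = (\<Sum>k\<in>UNIV. net_flow r y k * hit_prob r A i k)"
    by (rule sum_net_flow_mult[symmetric])
  \<comment> \<open>Off \<open>A\<close> the net flow is 0; on \<open>A\<close> the hitting
    probability is the indicator of \<open>i\<close>.\<close>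
  also have "\<dots> = (\<Sum>k\<in>UNIV. if k = i then net_flow r y k else 0)"
    using y i by (intro sum.cong refl)
      (metis ComplI equilibrium_def hit_prob_boundary mult.right_neutral mult_zero_left mult_zero_right)
  also have "\<dots> = net_flow r y i" by simp
  finally show ?thesis .
qed

text \<open>Minus this value is the total trace rate out of \<open>j\<close>, so it is at most 0.
  Were it 0, the function would be harmonic at \<open>j\<close> as well, hence everywhere off
  \<open>A\<close>, and zero on \<open>A\<close>; it would then vanish, yet it is 1 at
  \<open>j\<close>.\<close>

lemma trace_exit_pos:
  assumes irr: "irreducible_rates r" and "A \<noteq> {}" and j: "j \<notin> A"
  shows "generator r (hit_prob r (insert j A) j) j < 0"
proof -
  have "0 \<le> trace_rate r (insert j A) j i" for i
    by (auto simp: trace_rate_def irreducible_rates_nonneg[OF irr] intro!: add_nonneg_nonneg sum_nonneg)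
  then have "generator r (hit_prob r (insert j A) j) j \<le> 0"
    using sum_trace_rate_out[OF irr, of j "insert j A"]
      sum_nonneg[of "insert j A" "trace_rate r (insert j A) j"] by simp
  moreover have "generator r (hit_prob r (insert j A) j) j \<noteq> 0"
  proof
    assume 0: "generator r (hit_prob r (insert j A) j) j = 0"
    have "hit_prob r (insert j A) j j = 0"
    proof (rule harmonic_zero[OF irr \<open>A \<noteq> {}\<close>, of "hit_prob r (insert j A) j"])
      fix i assume "i \<in> A"
      with j show "hit_prob r (insert j A) j i = 0" by (auto simp: hit_prob_boundary)
    next
      fix i assume "i \<notin> A"
      with 0 show "generator r (hit_prob r (insert j A) j) i = 0"
        by (cases "i = j") (simp_all add: hit_prob_harmonic[OF irr])
    qed
    then show False by (simp add: hit_prob_boundary)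
  qed
  ultimately show ?thesis by simp
qed

text \<open>The net flow of \<open>y\<close> lives on \<open>A\<close>, where \<open>?h\<close> is
  0, so their pairing vanishes. By duality this is the sum that gives the trace drift, except that
  \<open>j\<close> carries weight \<open>y j\<close> instead of 1.\<close>

lemma trace_drift_insert:
  assumes irr: "irreducible_rates r" and y: "equilibrium r A y" and j: "j \<notin> A"
  shows "trace_drift r (insert j A) j = (1 - y j) * generator r (hit_prob r (insert j A) j) j"
proof -
  let ?h = "hit_prob r (insert j A) j"
  have "0 = (\<Sum>k\<in>UNIV. net_flow r y k * ?h k)"
    using y j by (intro sum.neutral[symmetric] ballI)
      (metis ComplI equilibrium_def hit_prob_boundary insertCI mult_zero_left mult_zero_right)
  also have "\<dots> = (\<Sum>i\<in>UNIV. y i * generator r ?h i)"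
    by (rule sum_net_flow_mult)
  also have "\<dots> = (\<Sum>i\<in>insert j A. y i * generator r ?h i)"
    by (intro sum.mono_neutral_right) (auto simp: hit_prob_harmonic[OF irr])
  also have "\<dots> = y j * generator r ?h j + (\<Sum>i\<in>A. generator r ?h i)"
    using y j by (simp add: equilibrium_def)
  finally show ?thesis
    using j by (simp add: trace_drift_eq_generator[OF irr] algebra_simps)
qed

section \<open>Absorbing sets and their hulls\<close>

lemma absorbing_iff_equilibrium:
  assumes irr: "irreducible_rates r" and A: "A \<noteq> {}" and y: "equilibrium r A y"
  shows "absorbing r A \<longleftrightarrow> (\<forall>j. y j \<le> 1)"
proof -
  \<comment> \<open>The factor that multiplies \<open>1 - y j\<close> in the drift is strictly
    negative.\<close>
  have "trace_drift r (A \<union> {j}) j \<le> 0 \<longleftrightarrow> y j \<le> 1" if "j \<notin> A" for j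
    using trace_exit_pos[OF irr A that]
    by (simp add: trace_drift_insert[OF irr y that] mult_le_0_iff)
  moreover have "y j \<le> 1" if "j \<in> A" for j
    using y that by (simp add: equilibrium_def)
  ultimately show ?thesis
    unfolding absorbing_def by auto
qed

text \<open>By comparison the equilibrium lies below \<open>z\<close>, hence below 1.\<close>

lemma absorbing_if_superharmonic:
  assumes irr: "irreducible_rates r" and A: "A \<noteq> {}"
    and "\<And>i. i \<in> A \<Longrightarrow> z i = 1" and "\<And>i. z i \<le> 1" and "\<And>j. j \<notin> A \<Longrightarrow> net_flow r z j \<le> 0"
  shows "absorbing r A"
proof -
  obtain y where y: "equilibrium r A y" by (rule equilibrium_exists[OF irr A])
  have "y i \<le> 1" for i
    using equilibrium_le[OF irr A y assms(3,5), of i] assms(4)[of i] by simp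
  then show ?thesis by (simp add: absorbing_iff_equilibrium[OF irr A y])
qed

text \<open>The pointwise minimum of two equilibria is superharmonic off the intersection.\<close>

lemma absorbing_Int:
  assumes irr: "irreducible_rates r" and ne: "A \<inter> B \<noteq> {}"
    and A: "absorbing r A" and B: "absorbing r B"
  shows "absorbing r (A \<inter> B)"
proof -
  have "A \<noteq> {}" "B \<noteq> {}" using ne by auto
  then obtain x y where x: "equilibrium r A x" and y: "equilibrium r B y"
    using equilibrium_exists[OF irr] by metis
  have x1: "x i \<le> 1" and y1: "y i \<le> 1" for i
    using absorbing_iff_equilibrium[OF irr _ x] absorbing_iff_equilibrium[OF irr _ y]
      \<open>A \<noteq> {}\<close> \<open>B \<noteq> {}\<close> A B by auto
  \<comment> \<open>With the value at \<open>j\<close> fixed, raising the other values only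
    increases the inflow into \<open>j\<close>.\<close>
  have mono: "net_flow r z j \<le> net_flow r w j" if "z j = w j" "\<And>i. z i \<le> w i" for z w j
    unfolding net_flow_def using that
    by (intro sum_mono) (simp add: mult_right_mono irreducible_rates_nonneg[OF irr])
  show ?thesis
  proof (rule absorbing_if_superharmonic[OF irr ne, of "\<lambda>i. min (x i) (y i)"])
    fix j assume j: "j \<notin> A \<inter> B"
    \<comment> \<open>If \<open>j\<close> lies in just one of the sets, the equilibrium of that set
      is 1 at \<open>j\<close> and the other one attains the minimum.\<close>
    consider "x j \<le> y j" "j \<notin> A" | "y j \<le> x j" "j \<notin> B"
      using j x y x1[of j] y1[of j] unfolding equilibrium_def by force
    then show "net_flow r (\<lambda>i. min (x i) (y i)) j \<le> 0"
    proof cases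
      case 1
      then have "net_flow r (\<lambda>i. min (x i) (y i)) j \<le> net_flow r x j" by (intro mono) auto
      with 1 x show ?thesis by (simp add: equilibrium_def)
    next
      case 2
      then have "net_flow r (\<lambda>i. min (x i) (y i)) j \<le> net_flow r y j" by (intro mono) auto
      with 2 y show ?thesis by (simp add: equilibrium_def)
    qed
  qed (use x y x1 in \<open>auto simp: equilibrium_def min_le_iff_disj\<close>)
qed

lemma subset_absorbing_hull: "S \<subseteq> absorbing_hull r S"
  by (auto simp: absorbing_hull_def)

lemma absorbing_hull_subset: "absorbing r B \<Longrightarrow> S \<subseteq> B \<Longrightarrow> absorbing_hull r S \<subseteq> B"
  by (auto simp: absorbing_hull_def)

lemma absorbing_absorbing_hull:
  assumes irr: "irreducible_rates r" and S: "S \<noteq> {}"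
  shows "absorbing r (absorbing_hull r S)"
proof -
  \<comment> \<open>The empty family has intersection \<open>UNIV\<close>. That intersections stay
    above the nonempty \<open>S\<close> provides the nonemptiness required by
    \<open>absorbing_Int\<close>.\<close>
  have "absorbing r (\<Inter>F) \<and> S \<subseteq> \<Inter>F" if "F \<subseteq> {B. absorbing r B \<and> S \<subseteq> B}" "finite F" for F
    using that(2,1)
  proof (induction F rule: finite_induct)
    case empty
    then show ?case by (simp add: absorbing_def)
  next
    case (insert B F)
    then have "B \<inter> \<Inter>F \<noteq> {}" using S by blast
    with insert show ?case by (auto intro!: absorbing_Int[OF irr])
  qed
  from this[OF order.refl] show ?thesis by (simp add: absorbing_hull_def)
qed

lemma absorbing_drift_zero_iff:
  assumes irr: "irreducible_rates r" and inv: "invariant_distribution r \<mu>" and A: "A \<noteq> {}"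
  shows "absorbing r A \<and> (\<forall>i\<in>A. trace_drift r A i = 0) \<longleftrightarrow> A \<subseteq> {i. \<mu> i = Max (range \<mu>)}"
proof
  note pos = invariant_distribution_pos[OF irr inv]
  obtain a where a: "a \<in> A" using A by auto
  obtain y where y: "equilibrium r A y" by (rule equilibrium_exists[OF irr A])
  {
    assume "absorbing r A \<and> (\<forall>i\<in>A. trace_drift r A i = 0)"
    then have y1: "\<And>j. y j \<le> 1" and flow: "\<And>i. i \<in> A \<Longrightarrow> net_flow r y i = 0"
      using absorbing_iff_equilibrium[OF irr A y] trace_drift_equilibrium[OF irr y] by auto
    have ya: "\<And>i. i \<in> A \<Longrightarrow> y i = 1" using y by (simp add: equilibrium_def)
    have "net_flow r y j = 0" for j
      using flow y by (cases "j \<in> A") (simp_all add: equilibrium_def)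
    \<comment> \<open>Both have zero net flow everywhere and agree at \<open>a\<close>, so the
      equilibrium is a multiple of \<open>\<mu>\<close>.\<close>
    then have "y = (\<lambda>i. 1 / \<mu> a * \<mu> i)"
      using pos[of a] a ya
      by (intro net_flow_unique[OF irr, of "{a}"])
        (simp_all add: net_flow_scale[of r "1 / \<mu> a" \<mu>, simplified]
          invariant_distribution_net_flow[OF inv])
    then have y_eq: "y i = \<mu> i / \<mu> a" for i by simp
    have le: "\<mu> j \<le> \<mu> a" for j
      using y1[of j] pos[of a] by (simp add: y_eq)
    show "A \<subseteq> {i. \<mu> i = Max (range \<mu>)}"
    proof clarify
      fix i assume "i \<in> A"
      then have "\<mu> i = \<mu> a" using ya[of i] pos[of a] by (simp add: y_eq)
      then show "\<mu> i = Max (range \<mu>)"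
        using le by (auto intro!: Max_eqI[symmetric])
    qed
  }
  assume M: "A \<subseteq> {i. \<mu> i = Max (range \<mu>)}"
  \<comment> \<open>Since \<open>\<mu> a\<close> is the maximum, \<open>\<mu>\<close> divided by it
    is the equilibrium of \<open>A\<close>.\<close>
  let ?z = "\<lambda>i. 1 / \<mu> a * \<mu> i"
  have \<mu>a: "\<mu> a = Max (range \<mu>)" using M a by blast
  have z: "equilibrium r A ?z"
    using M pos[of a] unfolding equilibrium_def net_flow_scale
    by (auto simp: \<mu>a invariant_distribution_net_flow[OF inv])
  have "?z j \<le> 1" for j
    using pos[of a] Max_ge[of "range \<mu>" "\<mu> j"] by (simp add: \<mu>a)
  moreover have "trace_drift r A i = 0" if "i \<in> A" for i
    unfolding trace_drift_equilibrium[OF irr z that] net_flow_scale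
    by (simp add: invariant_distribution_net_flow[OF inv])
  ultimately show "absorbing r A \<and> (\<forall>i\<in>A. trace_drift r A i = 0)"
    using absorbing_iff_equilibrium[OF irr A z] by blast
qed



section \<open>The path\<close>

lemma drift_eq_net_flow:
  assumes irr: "irreducible_rates r" and y: "equilibrium r (absorbing_hull r (supp v)) y"
  shows "drift r v = net_flow r y"
  using y by (auto simp: drift_def trace_drift_equilibrium[OF irr y] equilibrium_def)

text \<open>The drift is a net flow and sums to 0, so if nonzero it is negative at some
  \<open>i\<close> in the hull. Were \<open>i\<close> outside the support, removing it would leave a
  smaller absorbing set above the support.\<close>

lemma supp_down_nonempty:
  assumes irr: "irreducible_rates r" and S: "supp v \<noteq> {}" and "drift r v \<noteq> (\<lambda>_. 0)"
  shows "supp_down r v \<noteq> {}"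
proof -
  define H where "H = absorbing_hull r (supp v)"
  have SH: "supp v \<subseteq> H" unfolding H_def by (rule subset_absorbing_hull)
  with S have "H \<noteq> {}" by blast
  obtain y where y: "equilibrium r H y"
    by (rule equilibrium_exists[OF irr \<open>H \<noteq> {}\<close>])
  have drift: "drift r v = net_flow r y"
    using drift_eq_net_flow[OF irr] y by (simp add: H_def)
  have y1: "y j \<le> 1" for j
    using absorbing_iff_equilibrium[OF irr \<open>H \<noteq> {}\<close> y] absorbing_absorbing_hull[OF irr S]
    by (simp add: H_def)
  have "\<exists>i. net_flow r y i < 0"
  proof (rule ccontr)
    assume "\<not> ?thesis"
    then have "net_flow r y i = 0" for i
      using sum_nonneg_eq_0_iff[of UNIV "net_flow r y"] by (simp add: sum_net_flow not_less)
    with drift assms(3) show False by auto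
  qed
  then obtain i where i: "net_flow r y i < 0" by blast
  with y have "i \<in> H" by (force simp: equilibrium_def)
  have "i \<in> supp v"
  proof (rule ccontr)
    assume "i \<notin> supp v"
    then have sub: "supp v \<subseteq> H - {i}" using SH by blast
    \<comment> \<open>The old \<open>y\<close> still serves as a bound: the only new condition is at
      \<open>i\<close>, where its net flow is negative.\<close>
    have "absorbing r (H - {i})"
      using sub S y y1 i
      by (intro absorbing_if_superharmonic[OF irr, of _ y]) (auto simp: equilibrium_def)
    from absorbing_hull_subset[OF this sub] \<open>i \<in> H\<close> show False by (auto simp: H_def)
  qed
  with i show ?thesis by (auto simp: supp_down_def drift)
qed

lemma step_time_pos:
  assumes "irreducible_rates r" and "supp v \<noteq> {}" and "drift r v \<noteq> (\<lambda>_. 0)"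
  shows "0 < step_time r v"
  using supp_down_nonempty[OF assms]
  by (auto simp: step_time_def supp_down_def supp_def divide_simps)

text \<open>Each step adds a multiple of a net flow, whose total is 0. The total 1 keeps the
  supports of all nodes nonempty.\<close>

lemma sum_node_point:
  assumes irr: "irreducible_rates r" and u: "(\<Sum>i\<in>UNIV. u i) = 1"
  shows "(\<Sum>i\<in>UNIV. node_point r u k i) = 1"
proof (induction k)
  case (Suc k)
  obtain T v where v: "path_node r u k = (T, v)" by fastforce
  have "supp v \<noteq> {}"
  proof
    assume "supp v = {}"
    then have "sum v UNIV \<le> 0" by (intro sum_nonpos) (auto simp: supp_def not_less)
    with Suc v show False by simp
  qed
  then have "absorbing_hull r (supp v) \<noteq> {}" using subset_absorbing_hull[of "supp v" r] by blast
  then obtain y where "equilibrium r (absorbing_hull r (supp v)) y"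
    by (rule equilibrium_exists[OF irr])
  then have "drift r v = net_flow r y" by (rule drift_eq_net_flow[OF irr])
  with Suc v show ?case
    by (simp add: sum.distrib sum_net_flow flip: sum_distrib_left)
qed (simp add: u)

lemma supp_node_point_nonempty:
  assumes "irreducible_rates r" and "(\<Sum>i\<in>UNIV. u i) = 1"
  shows "supp (node_point r u k) \<noteq> {}"
proof
  assume "supp (node_point r u k) = {}"
  then have "(\<Sum>i\<in>UNIV. node_point r u k i) \<le> 0"
    by (intro sum_nonpos) (auto simp: supp_def not_less)
  with sum_node_point[OF assms, of k] show False by simp
qed

lemma node_time_mono:
  assumes irr: "irreducible_rates r" and u: "(\<Sum>i\<in>UNIV. u i) = 1"
  shows "mono (node_time r u)"
proof (rule incseq_SucI)
  fix k
  show "node_time r u k \<le> node_time r u (Suc k)"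
    using step_time_pos[OF irr supp_node_point_nonempty[OF irr u], of k]
    by (auto simp: case_prod_beta Let_def intro: less_imp_le)
qed

lemma zeta_path_constant_iff:
  assumes irr: "irreducible_rates r" and u: "u \<in> prob_simplex"
  shows "(\<forall>t\<ge>0. zeta_path r u t = u) \<longleftrightarrow> drift r u = (\<lambda>_. 0)"
proof
  assume "drift r u = (\<lambda>_. 0)"
  then have "stop_index r u \<le> enat 0"
    unfolding stop_index_def by (intro INF_lower) simp
  then have "stop_index r u = 0" by (simp add: zero_enat_def[symmetric])
  then show "\<forall>t\<ge>0. zeta_path r u t = u"
    by (simp add: zeta_path_def zero_enat_def)
next
  assume const: "\<forall>t\<ge>0. zeta_path r u t = u"
  show "drift r u = (\<lambda>_. 0)"
  proof (rule ccontr)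
    assume drift: "drift r u \<noteq> (\<lambda>_. 0)"
    have sum: "(\<Sum>i\<in>UNIV. u i) = 1" using u by (simp add: prob_simplex_def)
    have time1: "node_time r u (Suc 0) = step_time r u" using drift by simp
    have pos: "0 < step_time r u"
      using step_time_pos[OF irr _ drift] supp_node_point_nonempty[OF irr sum, of 0] by simp
    \<comment> \<open>The midpoint of the first piece, where the path has left \<open>u\<close>
      along the drift.\<close>
    define t where "t = step_time r u / 2"
    have t: "0 < t" "t < step_time r u" using pos by (simp_all add: t_def)
    have "1 \<le> stop_index r u"
      unfolding stop_index_def
    proof (rule INF_greatest)
      fix k assume "k \<in> {k. drift r (node_point r u k) = (\<lambda>_. 0)}"
      then have "k \<noteq> 0" using drift by (cases k) auto
      then show "1 \<le> enat k" by (simp add: one_enat_def)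
    qed
    then have stop: "enat 0 < stop_index r u"
      by (rule less_le_trans[rotated]) (simp add: one_enat_def)
    let ?P = "\<lambda>k. enat k < stop_index r u \<and> node_time r u k \<le> t \<and> t < node_time r u (Suc k)"
    have P0: "?P 0"
    proof (intro conjI)
      show "node_time r u 0 \<le> t" using t(1) by simp
      show "t < node_time r u (Suc 0)" using t(2) time1 by (simp only:)
    qed (rule stop)
    \<comment> \<open>Later pieces begin no earlier than the end of the first one, which is beyond
      \<open>t\<close>; thus \<open>THE\<close> selects index 0.\<close>
    have unique: "k = 0" if "?P k" for k
    proof (rule ccontr)
      assume "k \<noteq> 0"
      then have "node_time r u (Suc 0) \<le> node_time r u k"
        by (intro monoD[OF node_time_mono[OF irr sum]]) simp
      with that t(2) time1 show False by linarith
    qed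
    have "(THE k. ?P k) = 0" by (rule the_equality[of ?P, OF P0 unique])
    moreover have "\<exists>k. ?P k" using P0 by blast
    ultimately have "zeta_path r u t = (\<lambda>i. u i + t * drift r u i)"
      by (simp only: zeta_path_def Let_def if_True) simp
    moreover have "zeta_path r u t = u" using const t(1) by simp
    ultimately have "u = (\<lambda>i. u i + t * drift r u i)" by (rule trans[OF sym, rotated])
    from fun_cong[OF this] have "drift r u i = 0" for i using t(1) by simp
    with drift show False by blast
  qed
qed

theorem proposition2p12:
  fixes r :: "'v::finite \<Rightarrow> 'v \<Rightarrow> real" and \<mu> :: "'v \<Rightarrow> real" and M A :: "'v set"
  assumes "irreducible_rates r"
    and "invariant_distribution r \<mu>"
    and "M = {i. \<mu> i = Max (range \<mu>)}"
    and "A \<noteq> {}"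
  shows "((\<forall>u\<in>face A. \<forall>t\<ge>0. zeta_path r u t = u)
            \<longleftrightarrow> absorbing r A \<and> (\<forall>i\<in>A. trace_drift r A i = 0))
       \<and> (absorbing r A \<and> (\<forall>i\<in>A. trace_drift r A i = 0) \<longleftrightarrow> A \<subseteq> M)"
proof -
  note irr = assms(1)
  have iff: "absorbing r B \<and> (\<forall>i\<in>B. trace_drift r B i = 0) \<longleftrightarrow> B \<subseteq> M" if "B \<noteq> {}" for B
    using absorbing_drift_zero_iff[OF assms(1,2) that] assms(3) by simp
  have "(\<forall>u\<in>face A. \<forall>t\<ge>0. zeta_path r u t = u) \<longleftrightarrow> (\<forall>u\<in>face A. drift r u = (\<lambda>_. 0))"
    using zeta_path_constant_iff[OF irr] by (auto simp: face_def)
  also have "\<dots> \<longleftrightarrow> A \<subseteq> M"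
  proof
    assume stat: "\<forall>u\<in>face A. drift r u = (\<lambda>_. 0)"
    \<comment> \<open>The uniform distribution on \<open>A\<close> has support exactly
      \<open>A\<close>, so its drift is the trace drift on the hull of \<open>A\<close>.\<close>
    define u where "u i = (if i \<in> A then 1 / card A else 0)" for i
    have "0 < card A" using \<open>A \<noteq> {}\<close> by (simp add: card_gt_0_iff)
    then have "u \<in> face A" "supp u = A"
      by (auto simp: face_def prob_simplex_def u_def supp_def sum.If_cases)
    then have "trace_drift r (absorbing_hull r A) i = 0" if "i \<in> absorbing_hull r A" for i
      using stat[rule_format, OF \<open>u \<in> face A\<close>, THEN fun_cong, of i] that \<open>supp u = A\<close>
      by (simp add: drift_def)
    moreover have "absorbing r (absorbing_hull r A)"
      by (rule absorbing_absorbing_hull[OF irr \<open>A \<noteq> {}\<close>])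
    \<comment> \<open>The equivalence of (b) and (c) is applied to the hull, and the inclusion
      passes down to \<open>A\<close>.\<close>
    ultimately have "absorbing_hull r A \<subseteq> M"
      using iff[of "absorbing_hull r A"] by blast
    then show "A \<subseteq> M" using subset_absorbing_hull[of A r] by blast
  next
    assume AM: "A \<subseteq> M"
    show "\<forall>u\<in>face A. drift r u = (\<lambda>_. 0)"
    proof
      fix u assume u: "u \<in> face A"
      then have nonneg: "\<And>i. 0 \<le> u i" and "sum u UNIV = 1" "sum u A = 1"
        by (auto simp: face_def prob_simplex_def)
      then have "sum u (- A) = 0"
        using sum.subset_diff[of A UNIV u] by (simp add: Compl_eq_Diff_UNIV)
      then have "u i = 0" if "i \<notin> A" for i
        using nonneg that by (simp add: sum_nonneg_eq_0_iff)
      then have "supp u \<subseteq> A" by (fastforce simp: supp_def)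
      moreover have "absorbing r A" using iff[OF \<open>A \<noteq> {}\<close>] AM by blast
      \<comment> \<open>As \<open>A\<close> itself is absorbing, the hull of any smaller support
        stays inside \<open>A\<close>.\<close>
      ultimately have "absorbing_hull r (supp u) \<subseteq> M"
        using absorbing_hull_subset AM by blast
      then have "trace_drift r (absorbing_hull r (supp u)) i = 0"
        if "i \<in> absorbing_hull r (supp u)" for i
        using iff[of "absorbing_hull r (supp u)"] that by blast
      then show "drift r u = (\<lambda>_. 0)" by (auto simp: drift_def)
    qed
  qed
  finally show ?thesis using iff[OF \<open>A \<noteq> {}\<close>] by simp
qed

end
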